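(* Let $a:\mathbb{R}_+\times I\times I\to[0,1]$ be Lebesgue measurable and let $\phi:\mathbb{R}_+\to(0,+\infty)$ be locally Lipschitz continuous, positive and bounded. Let $x^0\in L^\infty(I,\mathbb{R}^d)$ and let $x(\cdot)\in\mathrm{Lip}_{\mathrm{loc}}(\mathbb{R}_+,L^2(I,\mathbb{R}^d))$ be the corresponding solution of $$\partial_t x(t,i)=\int_I a(t,i,j)\,\phi(|x(t,i)-x(t,j)|)\,(x(t,j)-x(t,i))\,\mathrm{d}j,\qquad x(0)=x^0 .$$ Then $\mathcal{C}(x(t))\subset\mathcal{C}(x^0)$ for all times $t\geq 0$.
   Context: $I:=[0,1]$ with the Lebesgue measure, $d\geq 1$ is an integer, $\mathbb{R}_+=[0,+\infty)$. The graphon dynamics is understood for almost every $t\geq 0$ and almost every $i\in I$. For a measurable map $y:I\to\mathbb{R}^d$, $\mathcal{C}(y)\subset\mathbb{R}^d$ denotes the closed convex hull of the essential range of $y$. *)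

theory Defs
  imports "HOL-Analysis.Analysis"
begin

abbreviation unit_measure :: "real measure" where
  "unit_measure \<equiv> lebesgue_on {0..1}"

definition essential_range :: "'a measure \<Rightarrow> ('a \<Rightarrow> 'b::metric_space) \<Rightarrow> 'b set" where
  "essential_range M y = {v. \<forall>e>0. emeasure M {i \<in> space M. dist (y i) v < e} > 0}"

definition ess_hull :: "(real \<Rightarrow> 'v::euclidean_space) \<Rightarrow> 'v set" where
  "ess_hull y = closure (convex hull (essential_range unit_measure y))"

definition locally_lipschitz_on :: "'a::metric_space set \<Rightarrow> ('a \<Rightarrow> 'b::metric_space) \<Rightarrow> bool" where
  "locally_lipschitz_on X f \<longleftrightarrow> (\<forall>r\<in>X. \<exists>u>0. \<exists>L. L-lipschitz_on (cball r u \<inter> X) f)"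

definition in_Linf :: "(real \<Rightarrow> 'v::euclidean_space) \<Rightarrow> bool" where
  "in_Linf y \<longleftrightarrow> y \<in> borel_measurable unit_measure \<and> (\<exists>C. AE i in unit_measure. norm (y i) \<le> C)"

text \<open>Elements of the spaces of square-integrable or essentially bounded maps are represented by
  functions; every notion below depends only on the class of these functions modulo equality
  almost everywhere.\<close>

definition in_L2 :: "(real \<Rightarrow> 'v::euclidean_space) \<Rightarrow> bool" where
  "in_L2 y \<longleftrightarrow> y \<in> borel_measurable unit_measure \<and> integrable unit_measure (\<lambda>i. (norm (y i))\<^sup>2)"

definition norm_L2 :: "(real \<Rightarrow> 'v::euclidean_space) \<Rightarrow> real" where
  "norm_L2 y = sqrt (LINT i|unit_measure. (norm (y i))\<^sup>2)"

definition lip_loc_L2 :: "(real \<Rightarrow> real \<Rightarrow> 'v::euclidean_space) \<Rightarrow> bool" where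
  "lip_loc_L2 x \<longleftrightarrow> (\<forall>t\<ge>0. in_L2 (x t)) \<and>
     (\<forall>r\<ge>0. \<exists>u>0. \<exists>L. \<forall>s\<in>cball r u \<inter> {0..}. \<forall>t\<in>cball r u \<inter> {0..}.
        norm_L2 (\<lambda>i. x s i - x t i) \<le> L * \<bar>s - t\<bar>)"

text \<open>A value \<open>x t\<close> is a class modulo null sets, so the time derivative is that of the curve
  with values in the Hilbert space of square-integrable maps: the difference quotients converge
  in norm.\<close>

definition has_L2_derivative ::
    "(real \<Rightarrow> real \<Rightarrow> 'v::euclidean_space) \<Rightarrow> (real \<Rightarrow> 'v) \<Rightarrow> real \<Rightarrow> bool" where
  "has_L2_derivative x v t \<longleftrightarrow> in_L2 v \<and>
     ((\<lambda>s. norm_L2 (\<lambda>i. (x s i - x t i) /\<^sub>R (s - t) - v i)) \<longlongrightarrow> 0) (at t within {0..})"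

definition graphon_solution ::
    "(real \<Rightarrow> real \<Rightarrow> real \<Rightarrow> real) \<Rightarrow> (real \<Rightarrow> real) \<Rightarrow> (real \<Rightarrow> 'v::euclidean_space)
      \<Rightarrow> (real \<Rightarrow> real \<Rightarrow> 'v) \<Rightarrow> bool" where
  "graphon_solution a \<phi> x0 x \<longleftrightarrow> lip_loc_L2 x \<and>
     (AE t in lebesgue_on {0..}. \<exists>v. has_L2_derivative x v t \<and>
        (AE i in unit_measure. v i =
           (LINT j|unit_measure. (a t i j * \<phi> (norm (x t i - x t j))) *\<^sub>R (x t j - x t i)))) \<and>
     (AE i in unit_measure. x 0 i = x0 i)"

end

theory Submission
  imports Defs
begin

text \<open>
  A closed convex hull is an intersection of half-spaces, so it suffices to propagate a single
  inequality \<open>w \<bullet> x \<le> b\<close>. Let \<open>p(t, i)\<close> be the positive part of \<open>w \<bullet> x(t, i) - b\<close> and \<open>E(t)\<close> the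
  integral of \<open>p(t, \<cdot>)\<^sup>2\<close>. Where \<open>p(t, i) > 0\<close>, the force along \<open>w\<close> exerted by \<open>j\<close> on \<open>i\<close> is at most
  \<open>sup \<phi> * p(t, j)\<close>, so \<open>E' \<le> 2 * sup \<phi> * (\<integral> p)\<^sup>2 \<le> 2 * sup \<phi> * E\<close> for almost every \<open>t\<close>. As \<open>E\<close>
  is locally Lipschitz and \<open>E(0) = 0\<close>, Gronwall's argument gives \<open>E = 0\<close>. Only an upper bound for
  the right derivative of \<open>E\<close> is used; the exceptional null set of times is absorbed by the measure
  of a small open neighbourhood.
\<close>

section \<open>Lipschitz functions with almost everywhere bounded right derivative\<close>

text \<open>Closedness puts the supremum of \<open>S\<close> within the interval into
  \<open>S\<close>; were it smaller than \<open>b\<close>, \<open>step\<close> would produce a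
  larger element. Note that \<open>step\<close> asks for one further point only, with no uniform
  step length.\<close>

lemma real_continuous_induction:
  fixes a b :: real and S :: "real set"
  assumes "a \<le> b" "a \<in> S" "closed (S \<inter> {a..b})"
    and step: "\<And>t. \<lbrakk>t \<in> S; a \<le> t; t < b\<rbrakk> \<Longrightarrow> \<exists>s\<in>S. t < s \<and> s \<le> b"
  shows "b \<in> S"
proof -
  let ?T = "S \<inter> {a..b}"
  have ne: "?T \<noteq> {}" and bd: "bdd_above ?T"
    using assms(1,2) by auto
  have sup: "Sup ?T \<in> ?T"
    using closed_contains_Sup[OF ne bd assms(3)] .
  show ?thesis
  proof (cases "Sup ?T = b")
    case False
    with sup step[of "Sup ?T"] obtain s where "s \<in> S" "Sup ?T < s" "s \<le> b"
      by auto
    moreover from this sup have "s \<in> ?T"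
      by auto
    ultimately show ?thesis
      using cSup_upper[OF _ bd, of s] by auto
  qed (use sup in auto)
qed

text \<open>Continuous induction on the set where \<open>g t \<le> g a\<close>, which is closed
  because \<open>g\<close> is continuous. The length \<open>\<delta>\<close> may shrink arbitrarily
  as \<open>t\<close> varies.\<close>

lemma nonincreasing_if_right_nonincreasing:
  fixes g :: "real \<Rightarrow> real"
  assumes "a \<le> b" "continuous_on {a..b} g"
    and step: "\<And>t. \<lbrakk>a \<le> t; t < b\<rbrakk> \<Longrightarrow> \<exists>\<delta>>0. \<forall>s\<in>{t<..<t+\<delta>} \<inter> {..b}. g s \<le> g t"
  shows "g b \<le> g a"
proof -
  have "b \<in> {t. g t \<le> g a}"
  proof (rule real_continuous_induction[where a = a])
    have "closed {t\<in>{a..b}. g t \<in> {..g a}}"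
      using continuous_closed_preimage[OF assms(2) closed_atLeastAtMost closed_atMost]
      by (simp add: vimage_def Int_def)
    then show "closed ({t. g t \<le> g a} \<inter> {a..b})"
      by (simp add: Int_def conj_commute)
  next
    fix t assume t: "t \<in> {t. g t \<le> g a}" "a \<le> t" "t < b"
    obtain \<delta> where "\<delta> > 0" and d: "\<forall>s\<in>{t<..<t+\<delta>} \<inter> {..b}. g s \<le> g t"
      using step[of t] t by auto
    define s where "s = min b (t + \<delta>/2)"
    have "s \<in> {t<..<t+\<delta>} \<inter> {..b}"
      using t \<open>\<delta> > 0\<close> by (auto simp: s_def min_def)
    then show "\<exists>s\<in>{t. g t \<le> g a}. t < s \<and> s \<le> b"
      using d t by (intro bexI[of _ s]) force+
  qed (use assms in auto)
  then show ?thesis by simp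
qed

text \<open>A one-sided substitute for the fundamental theorem of calculus that asks for no
  derivative of \<open>f\<close>. The Lipschitz bound controls \<open>f\<close> at the exceptional
  times. Continuity alone would be too weak: the Cantor function has slope 0 almost everywhere and
  still increases.\<close>

lemma lipschitz_AE_right_slope_le:
  fixes f :: "real \<Rightarrow> real"
  assumes "a \<le> b" and lip: "C-lipschitz_on {a..b} f"
    and ae: "AE t in lebesgue. t \<in> {a..<b} \<longrightarrow>
      (\<forall>\<epsilon>>0. \<exists>\<delta>>0. \<forall>s\<in>{t<..<t+\<delta>} \<inter> {..b}. f s - f t \<le> (c + \<epsilon>) * (s - t))"
  shows "f b - f a \<le> c * (b - a)"
proof -
  have C: "C \<ge> 0" using lipschitz_on_nonneg[OF lip] .
  obtain N where N: "N \<in> null_sets lebesgue" and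
    good: "\<And>t \<epsilon>. \<lbrakk>t \<notin> N; t \<in> {a..<b}; \<epsilon> > 0\<rbrakk> \<Longrightarrow>
      \<exists>\<delta>>0. \<forall>s\<in>{t<..<t+\<delta>} \<inter> {..b}. f s - f t \<le> (c + \<epsilon>) * (s - t)"
  proof -
    from ae obtain N where "N \<in> null_sets lebesgue" and
      "{t \<in> space lebesgue. \<not> (t \<in> {a..<b} \<longrightarrow>
        (\<forall>\<epsilon>>0. \<exists>\<delta>>0. \<forall>s\<in>{t<..<t+\<delta>} \<inter> {..b}. f s - f t \<le> (c + \<epsilon>) * (s - t)))} \<subseteq> N"
      unfolding eventually_ae_filter by auto
    then show ?thesis
      by (intro that[of N]) (blast, simp add: subset_iff, meson)
  qed
  \<comment> \<open>On an open neighbourhood \<open>U\<close> of the exceptional set, the measure of \<open>U \<inter> {a..t}\<close> grows at unit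
    speed, so subtracting a multiple of it from \<open>f\<close> compensates the missing slope bound.\<close>
  have main: "f b - f a \<le> c * (b - a) + \<epsilon> * (C + \<bar>c\<bar> + (b - a))" if "\<epsilon> > 0" for \<epsilon>
  proof -
    obtain U where U: "open U" "N \<subseteq> U" "U - N \<in> lmeasurable" "emeasure lebesgue (U - N) < ennreal \<epsilon>"
      using sets_lebesgue_outer_open[of N \<epsilon>] N \<open>\<epsilon> > 0\<close> by auto
    have Us: "U \<in> sets lebesgue" using U(1) by auto
    define m where "m t = measure lebesgue (U \<inter> {a..t})" for t
    have fin: "U \<inter> {a..t} \<in> lmeasurable" for t
      by (rule fmeasurableI2[of "{a..t}"]) (simp_all add: Us sets.Int)
    have m_mono: "m t \<le> m s" if "t \<le> s" for s t
      unfolding m_def using that by (intro measure_mono_fmeasurable fin fmeasurableD) auto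
    have m_upper: "m s - m t \<le> s - t" if "t \<le> s" for s t
    proof -
      have "m s \<le> measure lebesgue (U \<inter> {a..t} \<union> {t..s})"
        unfolding m_def by (intro measure_mono_fmeasurable fmeasurable.Un fin fmeasurableD) auto
      also have "\<dots> \<le> m t + measure lebesgue {t..s}"
        unfolding m_def by (intro measure_Un_le fmeasurableD fin) auto
      finally show ?thesis using that by simp
    qed
    have m_eq: "m s - m t \<ge> s - t" if "a \<le> t" "t \<le> s" "{t<..<s} \<subseteq> U" for s t
    proof -
      have diff: "{t<..<s} - U \<inter> {a..t} = {t<..<s}"
        by auto
      have "m t + measure lebesgue {t<..<s} = measure lebesgue (U \<inter> {a..t} \<union> {t<..<s})"
        unfolding m_def by (subst measure_Un2[OF fin]) (simp_all add: diff)
      also have "\<dots> \<le> m s"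
        unfolding m_def using that
        by (intro measure_mono_fmeasurable fin fmeasurableD fmeasurable.Un) auto
      finally show ?thesis using that by simp
    qed
    have m_b: "m b \<le> \<epsilon>"
    proof -
      have "emeasure lebesgue (U \<inter> {a..b}) \<le> emeasure lebesgue ((U - N) \<union> N)"
        using Us N by (intro emeasure_mono) auto
      also have "\<dots> = emeasure lebesgue (U - N)"
        using U(3) N by (intro emeasure_Un_null_set) auto
      finally have "emeasure lebesgue (U \<inter> {a..b}) \<le> ennreal \<epsilon>"
        using U(4) by simp
      then show ?thesis
        unfolding m_def measure_def using \<open>\<epsilon> > 0\<close> by (simp add: enn2real_leI)
    qed
    have m_a: "m a \<ge> 0" by (simp add: m_def)
    \<comment> \<open>At a point of \<open>N\<close> the function \<open>m\<close> grows at unit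
      speed, so \<open>D * m\<close> must dominate both the growth of \<open>f\<close>, at rate at
      most \<open>C\<close>, and the term \<open>- c * t\<close> of \<open>g\<close>, which
      increases at rate \<open>\<bar>c\<bar>\<close> when \<open>c\<close> is negative.\<close>
    define D where "D = C + \<bar>c\<bar>"
    define g where "g t = f t - D * m t - (c + \<epsilon>) * t" for t
    have "1-lipschitz_on {a..b} m"
    proof (rule lipschitz_onI)
      fix s t show "dist (m s) (m t) \<le> 1 * dist s t"
        using m_upper[of s t] m_mono[of s t] m_upper[of t s] m_mono[of t s]
        by (cases "s \<le> t") (auto simp: dist_real_def)
    qed simp
    then have cont: "continuous_on {a..b} g"
      unfolding g_def using lip by (intro continuous_intros lipschitz_on_continuous_on) auto
    have "g b \<le> g a"
    proof (rule nonincreasing_if_right_nonincreasing[OF \<open>a \<le> b\<close> cont])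
      fix t assume t: "a \<le> t" "t < b"
      show "\<exists>\<delta>>0. \<forall>s\<in>{t<..<t+\<delta>} \<inter> {..b}. g s \<le> g t"
      proof (cases "t \<in> N")
        case True
        then obtain \<delta> where "\<delta> > 0" and d: "ball t \<delta> \<subseteq> U"
          using U(1,2) open_contains_ball by blast
        have "g s \<le> g t" if s: "s \<in> {t<..<t+\<delta>} \<inter> {..b}" for s
        proof -
          have "{t<..<s} \<subseteq> U" using d s by (auto simp: dist_real_def subset_iff)
          then have "m s - m t \<ge> s - t" using m_eq s t by auto
          then have "D * (s - t) \<le> D * (m s - m t)" using C by (intro mult_left_mono) (auto simp: D_def)
          moreover have "f s - f t \<le> C * (s - t)"
            using lipschitz_onD[OF lip, of s t] s t by (auto simp: dist_real_def)
          moreover have "0 \<le> (c + \<bar>c\<bar>) * (s - t)" "0 \<le> \<epsilon> * (s - t)" using s \<open>\<epsilon> > 0\<close> by auto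
          ultimately show ?thesis unfolding g_def D_def by (simp add: algebra_simps)
        qed
        then show ?thesis using \<open>\<delta> > 0\<close> by blast
      next
        case False
        then obtain \<delta> where "\<delta> > 0"
          and d: "\<forall>s\<in>{t<..<t+\<delta>} \<inter> {..b}. f s - f t \<le> (c + \<epsilon>) * (s - t)"
          using good[of t \<epsilon>] t \<open>\<epsilon> > 0\<close> by auto
        have "g s \<le> g t" if s: "s \<in> {t<..<t+\<delta>} \<inter> {..b}" for s
        proof -
          \<comment> \<open>Off \<open>N\<close> the slope bound suffices, and monotonicity of
            \<open>m\<close> means that the correction does no harm.\<close>
          have "0 \<le> D * (m s - m t)" using m_mono[of t s] C s by (auto simp: D_def)
          then show ?thesis using d s unfolding g_def by (force simp: algebra_simps)
        qed
        then show ?thesis using \<open>\<delta> > 0\<close> by blast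
      qed
    qed
    moreover have "D * m b \<le> D * \<epsilon>" "0 \<le> D * m a" using m_b m_a C by (auto simp: D_def intro: mult_left_mono)
    ultimately show ?thesis unfolding g_def D_def by (simp add: algebra_simps)
  qed
  \<comment> \<open>The error in \<open>main\<close> is linear in \<open>\<epsilon>\<close>, with a
    factor independent of \<open>\<epsilon>\<close>, so it vanishes in the limit.\<close>
  have "((\<lambda>\<epsilon>. c * (b - a) + \<epsilon> * (C + \<bar>c\<bar> + (b - a))) \<longlongrightarrow> c * (b - a) + 0 * (C + \<bar>c\<bar> + (b - a))) (at_right 0)"
    by (intro tendsto_intros)
  then have "f b - f a \<le> c * (b - a) + 0 * (C + \<bar>c\<bar> + (b - a))"
    by (rule tendsto_lowerbound) (auto intro!: eventually_at_rightI[of 0 1] main)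
  then show ?thesis by simp
qed

lemma locally_lipschitz_on_imp_continuous_on:
  assumes "locally_lipschitz_on X f"
  shows "continuous_on X f"
  unfolding continuous_on_eq_continuous_within
proof
  fix r assume r: "r \<in> X"
  then obtain u L where "u > 0" "L-lipschitz_on (cball r u \<inter> X) f"
    using assms unfolding locally_lipschitz_on_def by blast
  then have "continuous (at r within (cball r u \<inter> X)) f"
    using r by (intro lipschitz_on_continuous_within) auto
  moreover have "at r within (cball r u \<inter> X) = at r within X"
    using \<open>u > 0\<close> by (intro at_within_nhd[of _ "ball r u"]) auto
  ultimately show "continuous (at r within X) f" by (simp add: continuous_within)
qed

text \<open>Zeros of \<open>E\<close> form a closed set, so by continuous induction it is enough to
  find, after each zero, a slightly later one. Starting from the value 0, a maximum argument on a
  short interval takes the place of an exponential integrating factor.\<close>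

lemma Gronwall_AE_zero:
  fixes E :: "real \<Rightarrow> real"
  assumes lip: "locally_lipschitz_on {0..} E" and nonneg: "\<And>t. t \<ge> 0 \<Longrightarrow> E t \<ge> 0" and "E 0 = 0"
    and "k \<ge> 0"
    and ae: "AE t in lebesgue. t \<in> {0..} \<longrightarrow>
      (\<forall>\<epsilon>>0. \<exists>\<delta>>0. \<forall>s\<in>{t<..<t+\<delta>}. E s - E t \<le> (k * E t + \<epsilon>) * (s - t))"
    and "T \<ge> 0"
  shows "E T = 0"
proof -
  have cont: "continuous_on {0..} E"
    using lip by (rule locally_lipschitz_on_imp_continuous_on)
  have "T \<in> {t. E t = 0}"
  proof (rule real_continuous_induction[where a = 0])
    have "closed {t\<in>{0..T}. E t \<in> {0}}"
      using continuous_closed_preimage[OF continuous_on_subset[OF cont]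
          closed_atLeastAtMost[of 0 T] closed_singleton[of 0]]
      by (auto simp add: vimage_def Int_def)
    then show "closed ({t. E t = 0} \<inter> {0..T})"
      by (simp add: Int_def conj_commute)
  next
    fix r assume r: "r \<in> {t. E t = 0}" "0 \<le> r" "r < T"
    obtain u L where u: "u > 0" and L: "L-lipschitz_on (cball r u \<inter> {0..}) E"
      using lip r unfolding locally_lipschitz_on_def by blast
    \<comment> \<open>On an interval of length at most \<open>1 / (2 * (k + 1))\<close> after \<open>r\<close>, the maximum of \<open>E\<close> is at most
      half of itself.\<close>
    define q where "q = min T (r + min u (1 / (2 * (k + 1))))"
    have q: "r < q" "q \<le> T" "q - r \<le> u" "q - r \<le> 1 / (2 * (k + 1))"
      using u r \<open>k \<ge> 0\<close> by (auto simp: q_def)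
    obtain p where p: "p \<in> {r..q}" and pmax: "\<And>t. t \<in> {r..q} \<Longrightarrow> E t \<le> E p"
      using continuous_attains_sup[of "{r..q}" E] q r cont
      by (fastforce intro: continuous_on_subset)
    \<comment> \<open>Since \<open>p\<close> maximises \<open>E\<close>, the varying bound
      \<open>k * E t\<close> can be replaced by the constant \<open>k * E p\<close>, as the slope
      lemma requires.\<close>
    have "E p - E r \<le> (k * E p) * (p - r)"
    proof (rule lipschitz_AE_right_slope_le)
      show "L-lipschitz_on {r..p} E"
        using p q r by (intro lipschitz_on_subset[OF L]) (auto simp: dist_real_def)
      show "AE t in lebesgue. t \<in> {r..<p} \<longrightarrow>
        (\<forall>\<epsilon>>0. \<exists>\<delta>>0. \<forall>s\<in>{t<..<t+\<delta>} \<inter> {..p}. E s - E t \<le> (k * E p + \<epsilon>) * (s - t))"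
        using ae
      proof eventually_elim
        case (elim t)
        show ?case
        proof safe
          fix \<epsilon> :: real assume t: "t \<in> {r..<p}" and "\<epsilon> > 0"
          then obtain \<delta> where "\<delta> > 0" and d: "\<forall>s\<in>{t<..<t+\<delta>}. E s - E t \<le> (k * E t + \<epsilon>) * (s - t)"
            using elim r by auto
          have "k * E t \<le> k * E p" using pmax[of t] t p \<open>k \<ge> 0\<close> by (intro mult_left_mono) auto
          then have "(k * E t + \<epsilon>) * (s - t) \<le> (k * E p + \<epsilon>) * (s - t)" if "s > t" for s
            using that by (intro mult_right_mono) auto
          then show "\<exists>\<delta>>0. \<forall>s\<in>{t<..<t+\<delta>} \<inter> {..p}. E s - E t \<le> (k * E p + \<epsilon>) * (s - t)"
            using d \<open>\<delta> > 0\<close> 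
            by (intro exI[of _ \<delta>]) (meson IntD1 greaterThanLessThan_iff order_trans)
        qed
      qed
    qed (use p in auto)
    moreover have "(k * E p) * (p - r) \<le> (k * E p) * (1 / (2 * (k + 1)))"
      using p q r \<open>k \<ge> 0\<close> nonneg[of p] by (intro mult_left_mono) auto
    moreover have "(k * E p) * (1 / (2 * (k + 1))) \<le> E p / 2"
      using \<open>k \<ge> 0\<close> nonneg[of p] p r by (auto simp: field_simps)
    ultimately have "E p \<le> 0" using r unfolding mem_Collect_eq by linarith
    then have "E q = 0"
      using pmax[of q] nonneg[of q] q r by auto
    then show "\<exists>s\<in>{t. E t = 0}. r < s \<and> s \<le> T"
      using q by auto
  qed (use assms in auto)
  then show ?thesis by simp
qed

section \<open>The essential range\<close>

text \<open>A point outside the essential range is the centre of a ball with null preimage. By the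
  Lindelof property, countably many open sets with null preimage cover all such points.\<close>

lemma AE_in_essential_range:
  fixes y :: "'a \<Rightarrow> 'b::{metric_space, second_countable_topology}"
  assumes "y \<in> borel_measurable M"
  shows "AE i in M. y i \<in> essential_range M y"
proof -
  define F where "F = {B. open B \<and> emeasure M {i \<in> space M. y i \<in> B} = 0}"
  obtain F' where F': "F' \<subseteq> F" "countable F'" "\<Union>F' = \<Union>F"
    using Lindelof[of F] by (auto simp: F_def)
  have "AE i in M. y i \<notin> B" if "B \<in> F" for B
  proof (rule AE_I')
    show "{i \<in> space M. y i \<in> B} \<in> null_sets M"
      using that measurable_sets[OF assms, of B] borel_open[of B]
      by (auto simp: F_def null_sets_def vimage_def Int_def conj_commute)
  qed auto
  then have "AE i in M. \<forall>B\<in>F'. y i \<notin> B"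
    using F' by (subst AE_ball_countable) auto
  then show ?thesis
  proof eventually_elim
    case (elim i)
    show ?case unfolding essential_range_def
    proof safe
      fix e :: real assume "e > 0"
      show "emeasure M {j \<in> space M. dist (y j) (y i) < e} > 0"
      proof (rule ccontr)
        assume "\<not> ?thesis"
        then have "ball (y i) e \<in> F" by (auto simp: F_def dist_commute)
        then show False using elim F'(3) \<open>e > 0\<close> by (metis UnionE UnionI centre_in_ball)
      qed
    qed
  qed
qed

text \<open>A point outside \<open>S\<close> has a whole ball outside \<open>S\<close>, and
  \<open>y\<close> almost never enters that ball.\<close>

lemma essential_range_subset_closed:
  assumes "closed S" and ae: "AE i in M. y i \<in> S"
  shows "essential_range M y \<subseteq> S"
proof
  fix v assume v: "v \<in> essential_range M y"
  show "v \<in> S"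
  proof (rule ccontr)
    assume "v \<notin> S"
    then obtain e where e: "e > 0" "ball v e \<subseteq> - S"
      using \<open>closed S\<close> open_contains_ball[of "- S"] by auto
    have "AE i in M. i \<notin> {i \<in> space M. dist (y i) v < e}"
      using ae by eventually_elim (use e in \<open>auto simp: dist_commute subset_iff\<close>)
    \<comment> \<open>A set that is not measurable has \<open>emeasure\<close> 0 by default, so both
      cases give the same value.\<close>
    then have "emeasure M {i \<in> space M. dist (y i) v < e} = 0"
      by (cases "{i \<in> space M. dist (y i) v < e} \<in> sets M")
         (simp_all add: AE_iff_measurable[OF _ refl] emeasure_notin_sets cong: conj_cong)
    then show False
      using v e unfolding essential_range_def by auto
  qed
qed

text \<open>This reduces the inclusion of hulls to scalar inequalities: a point outside the closed
  convex set \<open>ess_hull y\<close> is strictly separated from it by a hyperplane.\<close>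

lemma ess_hull_subset_if_halfspaces:
  fixes y z :: "real \<Rightarrow> 'v::euclidean_space"
  assumes y: "y \<in> borel_measurable unit_measure"
    and half: "\<And>w b. AE i in unit_measure. w \<bullet> y i \<le> b \<Longrightarrow> AE i in unit_measure. w \<bullet> z i \<le> b"
  shows "ess_hull z \<subseteq> ess_hull y"
proof -
  have "essential_range unit_measure z \<subseteq> ess_hull y"
  proof
    fix v assume v: "v \<in> essential_range unit_measure z"
    show "v \<in> ess_hull y"
    proof (rule ccontr)
      assume "v \<notin> ess_hull y"
      then obtain w b where w: "w \<bullet> v < b" "\<forall>p\<in>ess_hull y. w \<bullet> p > b"
        using separating_hyperplane_closed_point[of "ess_hull y" v]
        by (auto simp: ess_hull_def convex_closure)
      have sub: "essential_range unit_measure y \<subseteq> ess_hull y"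
        unfolding ess_hull_def by (meson closure_subset hull_subset order_trans)
      \<comment> \<open>Separation places the hull above level \<open>b\<close>; the signs are
        flipped to match the form of \<open>half\<close>.\<close>
      have "AE i in unit_measure. (- w) \<bullet> y i \<le> - b"
        using AE_in_essential_range[OF y]
        by (rule eventually_mono) (use w(2) sub in \<open>auto intro: less_imp_le\<close>)
      then have "AE i in unit_measure. (- w) \<bullet> z i \<le> - b"
        by (rule half)
      then have "essential_range unit_measure z \<subseteq> {p. (- w) \<bullet> p \<le> - b}"
        by (intro essential_range_subset_closed closed_halfspace_le) auto
      then show False using v w(1) by auto
    qed
  qed
  then show ?thesis
    unfolding ess_hull_def by (intro closure_minimal hull_minimal) (auto simp: convex_closure)
qed

section \<open>The excess over a half-space\<close>

lemma Cauchy_Schwarz_integral: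
  fixes f g :: "'a \<Rightarrow> real"
  assumes [measurable]: "f \<in> borel_measurable M" "g \<in> borel_measurable M"
    and f: "integrable M (\<lambda>i. (f i)\<^sup>2)" and g: "integrable M (\<lambda>i. (g i)\<^sup>2)"
  shows "integrable M (\<lambda>i. f i * g i)"
    and "(\<integral>i. f i * g i \<partial>M)\<^sup>2 \<le> (\<integral>i. (f i)\<^sup>2 \<partial>M) * (\<integral>i. (g i)\<^sup>2 \<partial>M)"
proof -
  show fg: "integrable M (\<lambda>i. f i * g i)"
  proof (rule Bochner_Integration.integrable_bound)
    show "integrable M (\<lambda>i. (f i)\<^sup>2 + (g i)\<^sup>2)"
      using f g by simp
    show "AE i in M. norm (f i * g i) \<le> norm ((f i)\<^sup>2 + (g i)\<^sup>2)"
    proof (rule AE_I2)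
      fix i
      have "2 * (\<bar>f i\<bar> * \<bar>g i\<bar>) \<le> (f i)\<^sup>2 + (g i)\<^sup>2"
        using sum_squares_bound[of "\<bar>f i\<bar>" "\<bar>g i\<bar>"] by simp
      moreover have "0 \<le> \<bar>f i\<bar> * \<bar>g i\<bar>" by simp
      ultimately show "norm (f i * g i) \<le> norm ((f i)\<^sup>2 + (g i)\<^sup>2)"
        unfolding real_norm_def abs_mult by linarith
    qed
  qed simp
  define A B C where "A = (\<integral>i. (f i)\<^sup>2 \<partial>M)" and "B = (\<integral>i. (g i)\<^sup>2 \<partial>M)" and "C = (\<integral>i. f i * g i \<partial>M)"
  have quad: "0 \<le> p\<^sup>2 * A - 2 * p * q * C + q\<^sup>2 * B" for p q
  proof -
    have "0 \<le> (\<integral>i. (p * f i - q * g i)\<^sup>2 \<partial>M)" by simp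
    also have "\<dots> = (\<integral>i. p\<^sup>2 * (f i)\<^sup>2 - (2 * p * q) * (f i * g i) + q\<^sup>2 * (g i)\<^sup>2 \<partial>M)"
      by (intro Bochner_Integration.integral_cong) (auto simp: power2_eq_square algebra_simps)
    also have "\<dots> = p\<^sup>2 * A - 2 * p * q * C + q\<^sup>2 * B"
      unfolding A_def B_def C_def using f g fg by simp
    finally show ?thesis .
  qed
  have "A \<ge> 0" by (simp add: A_def)
  have "C\<^sup>2 \<le> A * B"
  proof (cases "A = 0")
    case True
    have "C = 0"
    proof (rule ccontr)
      assume "C \<noteq> 0"
      \<comment> \<open>With \<open>A = 0\<close> and this choice of \<open>p\<close>, the quadratic
        form takes the value \<open>- (B + 1) + B = - 1\<close>.\<close>
      then show False using quad[of "(B + 1) / (2 * C)" 1] True by simp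
    qed
    then show ?thesis using True by simp
  next
    case False
    \<comment> \<open>The choice \<open>p = C\<close>, \<open>q = A\<close> makes the quadratic form
      equal to the right-hand side.\<close>
    have "0 \<le> A * (A * B - C\<^sup>2)"
      using quad[of C A] by (simp add: power2_eq_square algebra_simps)
    then show ?thesis using False \<open>A \<ge> 0\<close> by (simp add: zero_le_mult_iff)
  qed
  then show "(\<integral>i. f i * g i \<partial>M)\<^sup>2 \<le> (\<integral>i. (f i)\<^sup>2 \<partial>M) * (\<integral>i. (g i)\<^sup>2 \<partial>M)"
    by (simp add: A_def B_def C_def)
qed

section \<open>Square-integrable maps on the unit interval\<close>

lemma finite_measure_unit_measure: "finite_measure unit_measure"
  by (rule finite_measureI) (simp add: emeasure_restrict_space)

lemma norm_L2_nonneg: "norm_L2 y \<ge> 0"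
  by (simp add: norm_L2_def)

lemma norm_L2_squared: "(norm_L2 y)\<^sup>2 = (LINT i|unit_measure. (norm (y i))\<^sup>2)"
  by (simp add: norm_L2_def)

lemma in_L2_diff:
  assumes "in_L2 y" "in_L2 z"
  shows "in_L2 (\<lambda>i. y i - z i)"
proof -
  have [measurable]: "y \<in> borel_measurable unit_measure" "z \<in> borel_measurable unit_measure"
    using assms by (auto simp: in_L2_def)
  have "integrable unit_measure (\<lambda>i. (norm (y i - z i))\<^sup>2)"
  proof (rule Bochner_Integration.integrable_bound)
    show "integrable unit_measure (\<lambda>i. 2 * (norm (y i))\<^sup>2 + 2 * (norm (z i))\<^sup>2)"
      using assms by (auto simp: in_L2_def)
    show "AE i in unit_measure. norm ((norm (y i - z i))\<^sup>2) \<le> norm (2 * (norm (y i))\<^sup>2 + 2 * (norm (z i))\<^sup>2)"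
    proof (rule AE_I2)
      fix i
      have "(norm (y i - z i))\<^sup>2 \<le> (norm (y i) + norm (z i))\<^sup>2"
        by (intro power_mono norm_triangle_ineq4) auto
      also have "\<dots> \<le> 2 * (norm (y i))\<^sup>2 + 2 * (norm (z i))\<^sup>2"
        using sum_squares_bound[of "norm (y i)" "norm (z i)"] by (simp add: power2_sum)
      finally show "norm ((norm (y i - z i))\<^sup>2) \<le> norm (2 * (norm (y i))\<^sup>2 + 2 * (norm (z i))\<^sup>2)"
        by simp
    qed
  qed measurable
  then show ?thesis by (simp add: in_L2_def)
qed

lemma in_L2_scaleR:
  assumes "in_L2 y"
  shows "in_L2 (\<lambda>i. c *\<^sub>R y i)"
  using assms by (auto simp: in_L2_def power_mult_distrib)

lemma in_L2_inner:
  assumes "in_L2 y"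
  shows "(\<lambda>i. w \<bullet> y i) \<in> borel_measurable unit_measure"
    and "integrable unit_measure (\<lambda>i. (w \<bullet> y i)\<^sup>2)"
    and "(LINT i|unit_measure. (w \<bullet> y i)\<^sup>2) \<le> (norm w * norm_L2 y)\<^sup>2"
proof -
  have y: "y \<in> borel_measurable unit_measure" "integrable unit_measure (\<lambda>i. (norm (y i))\<^sup>2)"
    using assms by (auto simp: in_L2_def)
  show m: "(\<lambda>i. w \<bullet> y i) \<in> borel_measurable unit_measure"
    using y(1) by measurable
  have le: "(w \<bullet> y i)\<^sup>2 \<le> (norm w)\<^sup>2 * (norm (y i))\<^sup>2" for i
    using Cauchy_Schwarz_ineq[of w "y i"] by (simp add: power2_norm_eq_inner)
  have int: "integrable unit_measure (\<lambda>i. (norm w)\<^sup>2 * (norm (y i))\<^sup>2)"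
    using y by simp
  show i: "integrable unit_measure (\<lambda>i. (w \<bullet> y i)\<^sup>2)"
    by (rule Bochner_Integration.integrable_bound[OF int]) (use m le in auto)
  have "(LINT i|unit_measure. (w \<bullet> y i)\<^sup>2) \<le> (LINT i|unit_measure. (norm w)\<^sup>2 * (norm (y i))\<^sup>2)"
    by (intro integral_mono i int le)
  then show "(LINT i|unit_measure. (w \<bullet> y i)\<^sup>2) \<le> (norm w * norm_L2 y)\<^sup>2"
    by (simp add: power_mult_distrib norm_L2_squared)
qed

section \<open>The positive part of an affine function and its energy\<close>

definition excess :: "'v::real_inner \<Rightarrow> real \<Rightarrow> ('a \<Rightarrow> 'v) \<Rightarrow> 'a \<Rightarrow> real" where
  "excess w b y i = max 0 (w \<bullet> y i - b)"

text \<open>Squaring smooths the kink of the positive part, so the energy has a first-order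
  expansion with quadratic remainder.\<close>

definition excess_energy :: "'v::euclidean_space \<Rightarrow> real \<Rightarrow> (real \<Rightarrow> 'v) \<Rightarrow> real" where
  "excess_energy w b y = (LINT i|unit_measure. (excess w b y i)\<^sup>2)"

lemma excess_nonneg: "excess w b y i \<ge> 0"
  by (simp add: excess_def)

lemma excess_energy_nonneg: "excess_energy w b y \<ge> 0"
  by (simp add: excess_energy_def)

lemma in_L2_excess:
  assumes "in_L2 y"
  shows "excess w b y \<in> borel_measurable unit_measure"
    and "integrable unit_measure (\<lambda>i. (excess w b y i)\<^sup>2)"
proof -
  \<comment> \<open>Finite total mass makes the constant \<open>b\<close> square integrable.\<close>
  interpret finite_measure unit_measure by (rule finite_measure_unit_measure)
  have [measurable]: "(\<lambda>i. w \<bullet> y i) \<in> borel_measurable unit_measure"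
    using in_L2_inner[OF assms] by simp
  show m: "excess w b y \<in> borel_measurable unit_measure"
    unfolding excess_def[abs_def] by measurable
  show "integrable unit_measure (\<lambda>i. (excess w b y i)\<^sup>2)"
  proof (rule Bochner_Integration.integrable_bound)
    show "integrable unit_measure (\<lambda>i. 2 * (w \<bullet> y i)\<^sup>2 + 2 * b\<^sup>2)"
      using in_L2_inner[OF assms] by simp
    show "AE i in unit_measure. norm ((excess w b y i)\<^sup>2) \<le> norm (2 * (w \<bullet> y i)\<^sup>2 + 2 * b\<^sup>2)"
    proof (rule AE_I2)
      fix i
      have "(excess w b y i)\<^sup>2 \<le> (w \<bullet> y i - b)\<^sup>2"
        by (auto simp: excess_def max_def)
      also have "\<dots> \<le> 2 * (w \<bullet> y i)\<^sup>2 + 2 * b\<^sup>2"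
        using sum_squares_bound[of "w \<bullet> y i" "- b"] by (simp add: power2_diff)
      finally show "norm ((excess w b y i)\<^sup>2) \<le> norm (2 * (w \<bullet> y i)\<^sup>2 + 2 * b\<^sup>2)"
        by simp
    qed
  qed (use m in measurable)
qed

lemma excess_energy_zero_iff:
  assumes "in_L2 y"
  shows "excess_energy w b y = 0 \<longleftrightarrow> (AE i in unit_measure. w \<bullet> y i \<le> b)"
proof -
  have "excess_energy w b y = 0 \<longleftrightarrow> (AE i in unit_measure. (excess w b y i)\<^sup>2 = 0)"
    unfolding excess_energy_def
    by (intro integral_nonneg_eq_0_iff_AE in_L2_excess assms) auto
  also have "\<dots> \<longleftrightarrow> (AE i in unit_measure. w \<bullet> y i \<le> b)"
    by (intro AE_cong) (auto simp: excess_def max_def)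
  finally show ?thesis .
qed

text \<open>This pairing is half the first-order term of the energy. The bound serves both the
  Lipschitz estimate and the remainder of the difference quotient.\<close>

lemma excess_inner_bound:
  assumes y: "in_L2 y" and h: "in_L2 h"
  shows "integrable unit_measure (\<lambda>i. excess w b y i * (w \<bullet> h i))"
    and "(LINT i|unit_measure. excess w b y i * (w \<bullet> h i))
      \<le> sqrt (excess_energy w b y) * (norm w * norm_L2 h)"
proof -
  let ?I = "LINT i|unit_measure. excess w b y i * (w \<bullet> h i)"
  note cs = Cauchy_Schwarz_integral[OF in_L2_excess(1)[OF y, of w b] in_L2_inner(1)[OF h, of w]
      in_L2_excess(2)[OF y] in_L2_inner(2)[OF h]]
  show "integrable unit_measure (\<lambda>i. excess w b y i * (w \<bullet> h i))" by (rule cs(1))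
  have "?I\<^sup>2 \<le> excess_energy w b y * (norm w * norm_L2 h)\<^sup>2"
    using cs(2) mult_left_mono[OF in_L2_inner(3)[OF h, of w] excess_energy_nonneg[of w b y]]
    by (simp add: excess_energy_def)
  then have "?I\<^sup>2 \<le> (sqrt (excess_energy w b y) * (norm w * norm_L2 h))\<^sup>2"
    by (simp add: power_mult_distrib excess_energy_nonneg)
  then show "?I \<le> sqrt (excess_energy w b y) * (norm w * norm_L2 h)"
    by (rule power2_le_imp_le) (simp add: excess_energy_nonneg norm_L2_nonneg)
qed

text \<open>The squared positive part has derivative \<open>2 * max 0 x\<close>, which is Lipschitz
  with constant 2; hence the coefficient 1 of the quadratic remainder.\<close>

lemma pos_part_square_le:
  fixes x h :: real
  shows "(max 0 (x + h))\<^sup>2 \<le> (max 0 x)\<^sup>2 + 2 * (max 0 x * h) + h\<^sup>2"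
proof (cases "x \<ge> 0")
  case True
  have "(max 0 (x + h))\<^sup>2 \<le> (x + h)\<^sup>2" by (auto simp: max_def)
  then show ?thesis using True by (simp add: power2_sum)
next
  case False
  then have "(max 0 (x + h))\<^sup>2 \<le> h\<^sup>2"
    by (auto simp: max_def intro!: power_mono)
  then show ?thesis using False by simp
qed

lemma excess_energy_diff_le:
  assumes y: "in_L2 y" and z: "in_L2 z"
  shows "excess_energy w b z - excess_energy w b y
    \<le> 2 * (LINT i|unit_measure. excess w b y i * (w \<bullet> (z i - y i)))
      + (norm w * norm_L2 (\<lambda>i. z i - y i))\<^sup>2"
proof -
  have h: "in_L2 (\<lambda>i. z i - y i)" using in_L2_diff[OF z y] .
  note int = excess_inner_bound(1)[OF y h, of w b] in_L2_excess(2)[OF y] in_L2_inner(2)[OF h]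
  have "excess_energy w b z \<le> (LINT i|unit_measure. (excess w b y i)\<^sup>2
      + 2 * (excess w b y i * (w \<bullet> (z i - y i))) + (w \<bullet> (z i - y i))\<^sup>2)"
    unfolding excess_energy_def
  proof (rule integral_mono)
    fix i
    show "(excess w b z i)\<^sup>2 \<le> (excess w b y i)\<^sup>2
      + 2 * (excess w b y i * (w \<bullet> (z i - y i))) + (w \<bullet> (z i - y i))\<^sup>2"
      using pos_part_square_le[of "w \<bullet> y i - b" "w \<bullet> (z i - y i)"]
      by (simp add: excess_def inner_diff_right algebra_simps)
  qed (use int in_L2_excess(2)[OF z] in simp_all)
  also have "\<dots> = excess_energy w b y + 2 * (LINT i|unit_measure. excess w b y i * (w \<bullet> (z i - y i)))
      + (LINT i|unit_measure. (w \<bullet> (z i - y i))\<^sup>2)"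
    unfolding excess_energy_def using int by simp
  finally show ?thesis using in_L2_inner(3)[OF h, of w] by simp
qed

section \<open>Evolution of the energy along a solution\<close>

text \<open>Where the excess at \<open>i\<close> is positive, \<open>w \<bullet> y i > b\<close>, so
  \<open>w \<bullet> (y j - y i)\<close> is at most the excess at \<open>j\<close>. Integrating over
  \<open>j\<close> and then against the excess at \<open>i\<close> gives
  \<open>B * P\<^sup>2\<close>.\<close>

lemma excess_dissipation:
  fixes y v :: "real \<Rightarrow> 'v::euclidean_space"
  assumes y: "in_L2 y"
    and K: "\<And>i j. \<lbrakk>i \<in> {0..1}; j \<in> {0..1}\<rbrakk> \<Longrightarrow> 0 \<le> K i j \<and> K i j \<le> B"
    and v: "AE i in unit_measure. v i = (LINT j|unit_measure. K i j *\<^sub>R (y j - y i))"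
  shows "(LINT i|unit_measure. excess w b y i * (w \<bullet> v i)) \<le> B * excess_energy w b y"
proof -
  interpret finite_measure unit_measure by (rule finite_measure_unit_measure)
  let ?p = "excess w b y"
  define P where "P = (LINT i|unit_measure. ?p i)"
  have p: "integrable unit_measure ?p"
    by (rule square_integrable_imp_integrable[OF in_L2_excess[OF y]])
  have "B \<ge> 0" using K[of 0 0] by auto
  have "P \<ge> 0" by (simp add: P_def excess_nonneg)
  have pv: "?p i * (w \<bullet> (LINT j|unit_measure. K i j *\<^sub>R (y j - y i))) \<le> ?p i * (B * P)"
    if i: "i \<in> {0..1}" for i
  proof (cases "?p i > 0 \<and> integrable unit_measure (\<lambda>j. K i j *\<^sub>R (y j - y i))")
    case True
    then have pos: "w \<bullet> y i > b" by (auto simp: excess_def max_def split: if_splits)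
    have "w \<bullet> (LINT j|unit_measure. K i j *\<^sub>R (y j - y i))
        = (LINT j|unit_measure. w \<bullet> (K i j *\<^sub>R (y j - y i)))"
      using True by (intro integral_inner_right[symmetric]) auto
    also have "\<dots> \<le> (LINT j|unit_measure. B * ?p j)"
    proof (rule integral_mono')
      show "integrable unit_measure (\<lambda>j. B * ?p j)" using p by simp
      show "0 \<le> B * ?p j" for j using \<open>B \<ge> 0\<close> by (simp add: excess_nonneg)
      fix j assume "j \<in> space unit_measure"
      then have Kij: "0 \<le> K i j" "K i j \<le> B" using K i by auto
      have "w \<bullet> (y j - y i) \<le> ?p j"
        using pos by (auto simp: excess_def inner_diff_right)
      then have "K i j * (w \<bullet> (y j - y i)) \<le> K i j * ?p j"
        using Kij by (intro mult_left_mono) auto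
      also have "\<dots> \<le> B * ?p j"
        using Kij by (intro mult_right_mono excess_nonneg)
      finally show "w \<bullet> (K i j *\<^sub>R (y j - y i)) \<le> B * ?p j" by simp
    qed
    also have "\<dots> = B * P" by (simp add: P_def)
    finally show ?thesis using True by (intro mult_left_mono) auto
  next
    case False \<comment> \<open>a divergent Bochner integral has the value 0\<close>
    then have "?p i = 0 \<or> (LINT j|unit_measure. K i j *\<^sub>R (y j - y i)) = 0"
      using excess_nonneg[of w b y i] by (auto simp: not_integrable_integral_eq)
    then show ?thesis
      using excess_nonneg[of w b y i] \<open>B \<ge> 0\<close> \<open>P \<ge> 0\<close> by auto
  qed
  have "(LINT i|unit_measure. ?p i * (w \<bullet> v i)) \<le> (LINT i|unit_measure. ?p i * (B * P))"
  \<comment> \<open>Integrability is known for the upper function only. Its nonnegativity covers the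
    case in which the left integral takes the default value 0.\<close>
  proof (rule integral_mono_AE')
    show "AE i in unit_measure. ?p i * (w \<bullet> v i) \<le> ?p i * (B * P)"
      using v AE_space by eventually_elim (use pv in auto)
  qed (use p \<open>B \<ge> 0\<close> \<open>P \<ge> 0\<close> in \<open>auto simp: excess_nonneg\<close>)
  also have "\<dots> = B * P\<^sup>2" by (simp add: P_def power2_eq_square)
  \<comment> \<open>Cauchy-Schwarz against the constant 1, the interval having total mass 1.\<close>
  also have "P\<^sup>2 \<le> excess_energy w b y"
    using Cauchy_Schwarz_integral(2)[of ?p unit_measure "\<lambda>_. 1"] in_L2_excess[OF y]
    by (simp add: P_def excess_energy_def measure_restrict_space)
  finally show ?thesis using \<open>B \<ge> 0\<close> by (simp add: mult_left_mono)
qed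

text \<open>The expansion bounds an increment of the energy by a multiple of
  \<open>sqrt (?E t)\<close> plus a quadratic term, so the energy is first bounded on the ball and
  then estimated between two arbitrary times.\<close>

lemma locally_lipschitz_excess_energy:
  assumes x: "lip_loc_L2 x"
  shows "locally_lipschitz_on {0..} (\<lambda>t. excess_energy w b (x t))"
  unfolding locally_lipschitz_on_def
proof
  fix r :: real assume "r \<in> {0..}"
  then obtain u L where "u > 0" and
    L: "\<And>s t. \<lbrakk>s \<in> cball r u \<inter> {0..}; t \<in> cball r u \<inter> {0..}\<rbrakk> \<Longrightarrow>
      norm_L2 (\<lambda>i. x s i - x t i) \<le> L * \<bar>s - t\<bar>"
    using x unfolding lip_loc_L2_def
    by (meson atLeast_iff)
  have inL2: "in_L2 (x t)" if "t \<ge> 0" for t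
    using x that by (auto simp: lip_loc_L2_def)
  let ?E = "\<lambda>t. excess_energy w b (x t)"
  \<comment> \<open>The constant \<open>L\<close> carries no sign condition, hence the absolute
    value.\<close>
  define M where "M = norm w * \<bar>L\<bar>"
  have "M \<ge> 0" by (simp add: M_def)
  have step: "?E s - ?E t \<le> 2 * sqrt (?E t) * (M * \<bar>s - t\<bar>) + (M * \<bar>s - t\<bar>)\<^sup>2"
    if st: "s \<in> cball r u \<inter> {0..}" "t \<in> cball r u \<inter> {0..}" for s t
  proof -
    have "norm_L2 (\<lambda>i. x s i - x t i) \<le> \<bar>L\<bar> * \<bar>s - t\<bar>"
      using L[OF st] mult_right_mono[OF abs_ge_self[of L] abs_ge_zero[of "s - t"]] by linarith
    then have M: "norm w * norm_L2 (\<lambda>i. x s i - x t i) \<le> M * \<bar>s - t\<bar>"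
      unfolding M_def mult.assoc by (intro mult_left_mono) auto
    have "?E s - ?E t \<le> 2 * (sqrt (?E t) * (norm w * norm_L2 (\<lambda>i. x s i - x t i)))
        + (norm w * norm_L2 (\<lambda>i. x s i - x t i))\<^sup>2"
      using excess_energy_diff_le[of "x t" "x s" w b] st
        excess_inner_bound(2)[of "x t" "\<lambda>i. x s i - x t i" w b] inL2 in_L2_diff[of "x s" "x t"]
      by force
    also have "\<dots> \<le> 2 * (sqrt (?E t) * (M * \<bar>s - t\<bar>)) + (M * \<bar>s - t\<bar>)\<^sup>2"
      using M by (intro add_mono mult_left_mono power_mono)
        (auto simp: excess_energy_nonneg norm_L2_nonneg)
    finally show ?thesis by simp
  qed
  define B where "B = ?E r + 2 * sqrt (?E r) * (M * u) + (M * u)\<^sup>2"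
  have B: "?E t \<le> B" if t: "t \<in> cball r u \<inter> {0..}" for t
  proof -
    have "M * \<bar>t - r\<bar> \<le> M * u"
      using t \<open>M \<ge> 0\<close> by (intro mult_left_mono) (auto simp: dist_real_def)
    then have "2 * sqrt (?E r) * (M * \<bar>t - r\<bar>) + (M * \<bar>t - r\<bar>)\<^sup>2 \<le> 2 * sqrt (?E r) * (M * u) + (M * u)\<^sup>2"
      
      using \<open>M \<ge> 0\<close> by (intro add_mono mult_left_mono[of "M * _"] power_mono) (auto simp: excess_energy_nonneg)
    then show ?thesis
      using step[of t r] t \<open>r \<in> {0..}\<close> \<open>u > 0\<close> by (auto simp: B_def)
  qed
  \<comment> \<open>Here \<open>B\<close> bounds the energy on the ball, and in the quadratic term
    one factor \<open>\<bar>s - t\<bar>\<close> is bounded by the diameter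
    \<open>2 * u\<close>.\<close>
  define C where "C = 2 * sqrt B * M + M\<^sup>2 * (2 * u)"
  have "B \<ge> 0" unfolding B_def using \<open>M \<ge> 0\<close> \<open>u > 0\<close> by (simp add: excess_energy_nonneg)
  have le: "?E s - ?E t \<le> C * \<bar>s - t\<bar>"
    if st: "s \<in> cball r u \<inter> {0..}" "t \<in> cball r u \<inter> {0..}" for s t
  proof -
    have "2 * sqrt (?E t) * (M * \<bar>s - t\<bar>) \<le> 2 * sqrt B * (M * \<bar>s - t\<bar>)"
      using B[OF st(2)] \<open>M \<ge> 0\<close> by (intro mult_right_mono) auto
    moreover have "\<bar>s - t\<bar> \<le> 2 * u" using st by (auto simp: dist_real_def)
    then have "(M\<^sup>2 * \<bar>s - t\<bar>) * \<bar>s - t\<bar> \<le> (M\<^sup>2 * \<bar>s - t\<bar>) * (2 * u)"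
      by (intro mult_left_mono) auto
    ultimately show ?thesis
      using step[OF st] by (simp add: C_def power_mult_distrib power2_eq_square algebra_simps)
  qed
  have "C-lipschitz_on (cball r u \<inter> {0..}) ?E"
  proof (rule lipschitz_onI)
    show "C \<ge> 0" unfolding C_def using \<open>B \<ge> 0\<close> \<open>M \<ge> 0\<close> \<open>u > 0\<close> by simp
    show "dist (?E s) (?E t) \<le> C * dist s t"
      if "s \<in> cball r u \<inter> {0..}" "t \<in> cball r u \<inter> {0..}" for s t
      using le[OF that] le[OF that(2,1)] by (auto simp: dist_real_def abs_minus_commute abs_le_iff)
  qed
  then show "\<exists>u>0. \<exists>L. L-lipschitz_on (cball r u \<inter> {0..}) ?E"
    using \<open>u > 0\<close> by blast
qed

text \<open>Writing the increment of \<open>x\<close> as \<open>s - t\<close> times \<open>v\<close>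
  plus a remainder, the part along \<open>v\<close> contributes at most \<open>2 * D\<close> to the
  slope. The remainder tends to 0 in norm, and the quadratic term is of order
  \<open>(s - t)\<^sup>2\<close>.\<close>

lemma excess_energy_right_slope:
  assumes x: "lip_loc_L2 x" and "t \<ge> 0" and v: "has_L2_derivative x v t"
    and diss: "(LINT i|unit_measure. excess w b (x t) i * (w \<bullet> v i)) \<le> D" and "\<epsilon> > 0"
  shows "\<exists>\<delta>>0. \<forall>s\<in>{t<..<t+\<delta>}. excess_energy w b (x s) - excess_energy w b (x t) \<le> (2 * D + \<epsilon>) * (s - t)"
proof -
  let ?E = "\<lambda>t. excess_energy w b (x t)"
  let ?R = "\<lambda>s i. (x s i - x t i) /\<^sub>R (s - t) - v i"
  have inL2: "in_L2 (x s)" if "s \<ge> 0" for s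
    using x that by (auto simp: lip_loc_L2_def)
  have vL2: "in_L2 v" using v by (simp add: has_L2_derivative_def)
  have lim: "((\<lambda>s. norm_L2 (?R s)) \<longlongrightarrow> 0) (at_right t)"
  proof (rule tendsto_within_subset)
    show "((\<lambda>s. norm_L2 (?R s)) \<longlongrightarrow> 0) (at t within {0..})"
      using v by (simp only: has_L2_derivative_def)
    show "{t<..} \<subseteq> {0..}"
      using \<open>t \<ge> 0\<close> by auto
  qed
  obtain u L where "u > 0" and
    L: "\<And>s. s \<in> cball t u \<inter> {0..} \<Longrightarrow> norm_L2 (\<lambda>i. x s i - x t i) \<le> L * \<bar>s - t\<bar>"
  proof -
    from x \<open>t \<ge> 0\<close> obtain u L where u: "u > 0" and
      *: "\<forall>s\<in>cball t u \<inter> {0..}. \<forall>r\<in>cball t u \<inter> {0..}. norm_L2 (\<lambda>i. x s i - x r i) \<le> L * \<bar>s - r\<bar>"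
      unfolding lip_loc_L2_def by blast
    moreover have "t \<in> cball t u \<inter> {0..}" using u \<open>t \<ge> 0\<close> by simp
    ultimately show ?thesis using that by blast
  qed
  \<comment> \<open>The three summands come from \<open>v\<close>, from the remainder
    \<open>?R s\<close>, and from the quadratic term after one factor \<open>s - t\<close> is split
    off.\<close>
  let ?B = "\<lambda>s. 2 * D + 2 * (sqrt (?E t) * (norm w * norm_L2 (?R s))) + (norm w * L)\<^sup>2 * (s - t)"
  have bound: "?E s - ?E t \<le> ?B s * (s - t)" if s: "s \<in> {t<..<t+u}" for s
  proof -
    have "s \<ge> 0" using s \<open>t \<ge> 0\<close> by auto
    have RL2: "in_L2 (?R s)"
      by (intro in_L2_diff in_L2_scaleR vL2 inL2 \<open>s \<ge> 0\<close> \<open>t \<ge> 0\<close>)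
    have eq: "excess w b (x t) i * (w \<bullet> (x s i - x t i))
        = (s - t) * (excess w b (x t) i * (w \<bullet> v i)) + (s - t) * (excess w b (x t) i * (w \<bullet> ?R s i))" for i
    proof -
      have "x s i - x t i = (s - t) *\<^sub>R v i + (s - t) *\<^sub>R ?R s i"
        using s by (simp add: scaleR_diff_right)
      from arg_cong[OF this, of "inner w"]
      have "w \<bullet> (x s i - x t i) = (s - t) * (w \<bullet> v i) + (s - t) * (w \<bullet> ?R s i)"
        by (rule trans) (simp only: inner_add_right inner_scaleR_right)
      then show ?thesis by (simp only: distrib_left mult.left_commute)
    qed
    have "(LINT i|unit_measure. excess w b (x t) i * (w \<bullet> (x s i - x t i)))
        = (s - t) * (LINT i|unit_measure. excess w b (x t) i * (w \<bullet> v i))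
        + (s - t) * (LINT i|unit_measure. excess w b (x t) i * (w \<bullet> ?R s i))"
      unfolding eq using excess_inner_bound(1)[OF inL2[OF \<open>t \<ge> 0\<close>] vL2, of w b]
        excess_inner_bound(1)[OF inL2[OF \<open>t \<ge> 0\<close>] RL2, of w b]
      by (subst Bochner_Integration.integral_add) (simp_all only: integrable_mult_right integral_mult_right_zero)
    also have "\<dots> \<le> (s - t) * D + (s - t) * (sqrt (?E t) * (norm w * norm_L2 (?R s)))"
      using s diss excess_inner_bound(2)[OF inL2[OF \<open>t \<ge> 0\<close>] RL2, of w b]
      by (intro add_mono mult_left_mono) auto
    finally have 1: "(LINT i|unit_measure. excess w b (x t) i * (w \<bullet> (x s i - x t i)))
      \<le> (s - t) * D + (s - t) * (sqrt (?E t) * (norm w * norm_L2 (?R s)))" .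
    have "norm_L2 (\<lambda>i. x s i - x t i) \<le> L * (s - t)"
      using L[of s] s \<open>s \<ge> 0\<close> by (auto simp: dist_real_def)
    then have "norm w * norm_L2 (\<lambda>i. x s i - x t i) \<le> norm w * L * (s - t)"
      unfolding mult.assoc by (intro mult_left_mono) auto
    then have 2: "(norm w * norm_L2 (\<lambda>i. x s i - x t i))\<^sup>2 \<le> (norm w * L * (s - t))\<^sup>2"
      by (intro power_mono) (auto simp: norm_L2_nonneg)
    have arith: "2 * (h * D + h * q) + (l * h)\<^sup>2 = (2 * D + 2 * q + l\<^sup>2 * h) * h" for h q l :: real
      by (simp add: power2_eq_square algebra_simps)
    have "?E s - ?E t \<le> 2 * ((s - t) * D + (s - t) * (sqrt (?E t) * (norm w * norm_L2 (?R s))))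
        + (norm w * L * (s - t))\<^sup>2"
      by (rule order_trans[OF excess_energy_diff_le[OF inL2[OF \<open>t \<ge> 0\<close>] inL2[OF \<open>s \<ge> 0\<close>]]])
        (intro add_mono mult_left_mono 1 2, simp)
    also have "\<dots> = ?B s * (s - t)"
      by (rule arith)
    finally show ?thesis .
  qed
  have "(?B \<longlongrightarrow> 2 * D + 2 * (sqrt (?E t) * (norm w * 0)) + (norm w * L)\<^sup>2 * (t - t)) (at_right t)"
    by (intro tendsto_intros lim)
  then have "eventually (\<lambda>s. ?B s < 2 * D + \<epsilon>) (at_right t)"
    by (rule order_tendstoD) (use \<open>\<epsilon> > 0\<close> in simp)
  then obtain d where "d > t" and d: "\<And>s. \<lbrakk>t < s; s < d\<rbrakk> \<Longrightarrow> ?B s < 2 * D + \<epsilon>"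
    unfolding eventually_at_right_field by auto
  have "?E s - ?E t \<le> (2 * D + \<epsilon>) * (s - t)" if s: "s \<in> {t<..<t + min u (d - t)}" for s
  proof -
    have "?B s * (s - t) \<le> (2 * D + \<epsilon>) * (s - t)"
      using s by (intro mult_right_mono less_imp_le[OF d]) auto
    with s show ?thesis by (intro order_trans[OF bound]) auto
  qed
  then show ?thesis using \<open>u > 0\<close> \<open>d > t\<close> by (intro exI[of _ "min u (d - t)"]) auto
qed

text \<open>The weight \<open>a t i j * \<phi> (norm (x t i - x t j))\<close> lies between 0 and any
  nonnegative upper bound \<open>B\<close> of \<open>\<phi>\<close>. The Gronwall rate is
  \<open>2 * B\<close>, with the factor 2 coming from the square in the energy.\<close>

lemma graphon_halfspace_invariant:
  fixes x0 :: "real \<Rightarrow> 'v::euclidean_space"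
  assumes a: "\<And>t i j. \<lbrakk>t \<in> {0..}; i \<in> {0..1}; j \<in> {0..1}\<rbrakk> \<Longrightarrow> a t i j \<in> {0..1}"
    and phi: "\<And>r. r \<ge> 0 \<Longrightarrow> \<phi> r > 0" "bounded (\<phi> ` {0..})"
    and sol: "graphon_solution a \<phi> x0 x"
    and x0: "AE i in unit_measure. w \<bullet> x0 i \<le> b"
    and "T \<ge> 0"
  shows "AE i in unit_measure. w \<bullet> x T i \<le> b"
proof -
  obtain B where B: "\<And>r. r \<ge> 0 \<Longrightarrow> \<phi> r \<le> B"
  proof -
    obtain B where "\<forall>y\<in>\<phi> ` {0..}. norm y \<le> B"
      using phi(2) unfolding bounded_iff by blast
    then show ?thesis
      by (intro that[of B]) (auto simp: abs_le_iff)
  qed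
  have "B \<ge> 0" using B[of 0] phi(1)[of 0] by simp
  have x: "lip_loc_L2 x" and init: "AE i in unit_measure. x 0 i = x0 i"
    using sol by (auto simp: graphon_solution_def)
  have inL2: "in_L2 (x t)" if "t \<ge> 0" for t
    using x that by (auto simp: lip_loc_L2_def)
  have "excess_energy w b (x T) = 0"
  proof (rule Gronwall_AE_zero[where k = "2 * B" and E = "\<lambda>t. excess_energy w b (x t)"])
    show "locally_lipschitz_on {0..} (\<lambda>t. excess_energy w b (x t))"
      using x by (rule locally_lipschitz_excess_energy)
    have "AE i in unit_measure. w \<bullet> x 0 i \<le> b"
      using init x0 by eventually_elim simp
    then show "excess_energy w b (x 0) = 0"
      using excess_energy_zero_iff[OF inL2[of 0]] by simp
    have "AE t in lebesgue_on {0..}. \<exists>v. has_L2_derivative x v t \<and>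
        (AE i in unit_measure. v i =
           (LINT j|unit_measure. (a t i j * \<phi> (norm (x t i - x t j))) *\<^sub>R (x t j - x t i)))"
      using sol by (simp add: graphon_solution_def)
    then have "AE t in lebesgue. t \<in> {0..} \<longrightarrow> (\<exists>v. has_L2_derivative x v t \<and>
        (AE i in unit_measure. v i =
           (LINT j|unit_measure. (a t i j * \<phi> (norm (x t i - x t j))) *\<^sub>R (x t j - x t i))))"
      by (subst (asm) AE_restrict_space_iff) auto
    then show "AE t in lebesgue. t \<in> {0..} \<longrightarrow> (\<forall>\<epsilon>>0. \<exists>\<delta>>0. \<forall>s\<in>{t<..<t+\<delta>}.
        excess_energy w b (x s) - excess_energy w b (x t) \<le> (2 * B * excess_energy w b (x t) + \<epsilon>) * (s - t))"
    proof eventually_elim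
      case (elim t)
      show ?case
      proof (intro impI allI)
        fix \<epsilon> :: real assume t: "t \<in> {0..}" and "\<epsilon> > 0"
        obtain v where v: "has_L2_derivative x v t" and
          eq: "AE i in unit_measure. v i =
           (LINT j|unit_measure. (a t i j * \<phi> (norm (x t i - x t j))) *\<^sub>R (x t j - x t i))"
          using elim t by blast
        have "(LINT i|unit_measure. excess w b (x t) i * (w \<bullet> v i)) \<le> B * excess_energy w b (x t)"
        proof (rule excess_dissipation[OF inL2 _ eq])
          fix i j :: real assume "i \<in> {0..1}" "j \<in> {0..1}"
          then have "0 \<le> a t i j" "a t i j \<le> 1" using a[OF t] by auto
          moreover have "0 < \<phi> (norm (x t i - x t j))" "\<phi> (norm (x t i - x t j)) \<le> B"
            using phi(1) B by auto
          ultimately show "0 \<le> a t i j * \<phi> (norm (x t i - x t j)) \<and> a t i j * \<phi> (norm (x t i - x t j)) \<le> B"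
            using mult_mono[of "a t i j" 1 "\<phi> (norm (x t i - x t j))" B] by auto
        qed (use t in auto)
        from excess_energy_right_slope[OF x _ v this \<open>\<epsilon> > 0\<close>] t
        show "\<exists>\<delta>>0. \<forall>s\<in>{t<..<t+\<delta>}.
          excess_energy w b (x s) - excess_energy w b (x t) \<le> (2 * B * excess_energy w b (x t) + \<epsilon>) * (s - t)"
          by (simp add: mult.assoc)
      qed
    qed
  qed (use \<open>B \<ge> 0\<close> \<open>T \<ge> 0\<close> in \<open>auto simp: excess_energy_nonneg\<close>)
  then show ?thesis
    using excess_energy_zero_iff[OF inL2[OF \<open>T \<ge> 0\<close>]] by simp
qed

theorem proposition2p11:
  fixes a :: "real \<Rightarrow> real \<Rightarrow> real \<Rightarrow> real"
    and \<phi> :: "real \<Rightarrow> real"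
    and x0 :: "real \<Rightarrow> real ^ 'd"
    and x :: "real \<Rightarrow> real \<Rightarrow> real ^ 'd"
  assumes "(\<lambda>(t, i, j). a t i j) \<in> borel_measurable (lebesgue_on ({0..} \<times> {0..1} \<times> {0..1}))"
    and "\<And>t i j. t \<in> {0..} \<Longrightarrow> i \<in> {0..1} \<Longrightarrow> j \<in> {0..1} \<Longrightarrow> a t i j \<in> {0..1}"
    and "locally_lipschitz_on {0..} \<phi>"
    and "\<And>r. r \<ge> 0 \<Longrightarrow> \<phi> r > 0"
    and "bounded (\<phi> ` {0..})"
    and "in_Linf x0"
    and "graphon_solution a \<phi> x0 x"
  shows "\<forall>t\<ge>0. ess_hull (x t) \<subseteq> ess_hull x0"
proof (intro allI impI)
  fix t :: real assume "t \<ge> 0"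
  show "ess_hull (x t) \<subseteq> ess_hull x0"
  proof (rule ess_hull_subset_if_halfspaces)
    show "x0 \<in> borel_measurable unit_measure"
      using assms(6) by (simp add: in_Linf_def)
    show "AE i in unit_measure. w \<bullet> x t i \<le> b" if "AE i in unit_measure. w \<bullet> x0 i \<le> b" for w b
      by (rule graphon_halfspace_invariant[OF assms(2,4,5,7) that \<open>t \<ge> 0\<close>])
  qed
qed

end
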